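(* Let $\sigma=\sigma_1\sigma_2\cdots\sigma_k$ be a Cayley permutation of length $k\ge 3$, and let $\hat\sigma=\sigma_2\sigma_1\sigma_3\cdots\sigma_k$. Then $\mathrm{Sort}^{\mathrm{Cay}}(\sigma)$ is not a class if and only if $\hat\sigma$ avoids $231$. Otherwise, if $\hat\sigma$ contains $231$, then $\mathrm{Sort}^{\mathrm{Cay}}(\sigma)$ is a class with basis $\{132,\mathcal{R}(\sigma)\}$ if $\mathcal{R}(\sigma)$ avoids $132$, and with basis $\{132\}$ otherwise.
   Context: A Cayley permutation is a word $x_1\cdots x_n$ of positive integers containing at least one copy of each integer from $1$ to its maximum value; $\mathrm{Cay}$ is the set of Cayley permutations. A word $x$ contains a pattern $y=y_1\cdots y_k$ if it has a subsequence $x_{i_1}\cdots x_{i_k}$ ($i_1<\dots<i_k$) such that for all $s,t$: $x_{i_s}<x_{i_t}$ iff $y_s<y_t$, and $x_{i_s}=x_{i_t}$ iff $y_s=y_t$; otherwise $x$ avoids $y$. A class (of Cayley permutations) is a subset of $\mathrm{Cay}$ closed downwards under pattern containment in $\mathrm{Cay}$; its basis is the set of Cayley permutations not in the class that are minimal with respect to containment. $\mathcal{R}(\sigma)=\sigma_k\cdots\sigma_1$. For a Cayley permutation $\sigma$ of length at least $2$, the $\sigma$-stack acts on an input word $\pi=\pi_1\cdots\pi_n$ of positive integers as follows (starting with empty stack and output). For $i=1,\dots,n$: as long as pushing $\pi_i$ on top of the stack would make the content of the stack, read from top to bottom, contain an occurrence of $\sigma$, pop the top element and append it to the output; then push $\pi_i$.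 After all letters have been pushed, pop all remaining elements, from top to bottom, appending them to the output. The resulting output is denoted $\mathcal{S}^{\sigma}(\pi)$. A Cayley permutation $\pi$ is $\sigma$-sortable if $\mathcal{S}^{21}(\mathcal{S}^{\sigma}(\pi))$ is weakly increasing. $\mathrm{Sort}^{\mathrm{Cay}}(\sigma)$ is the set of $\sigma$-sortable Cayley permutations. *)

theory Defs
  imports Main
begin

text \<open>Words are lists of natural numbers, and the empty word counts as a Cayley permutation.\<close>

definition cayley_perms :: "nat list set" where
  "cayley_perms = {w. w = [] \<or> set w = {1..Max (set w)}}"

definition contains :: "nat list \<Rightarrow> nat list \<Rightarrow> bool" where
  "contains x y \<longleftrightarrow>
     (\<exists>i :: nat \<Rightarrow> nat.
        strict_mono_on {..<length y} i \<and>
        (\<forall>s<length y. i s < length x) \<and>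
        (\<forall>s<length y. \<forall>t<length y.
           (x ! i s < x ! i t \<longleftrightarrow> y ! s < y ! t) \<and>
           (x ! i s = x ! i t \<longleftrightarrow> y ! s = y ! t)))"

abbreviation avoids :: "nat list \<Rightarrow> nat list \<Rightarrow> bool" where
  "avoids x y \<equiv> \<not> contains x y"

definition is_class :: "nat list set \<Rightarrow> bool" where
  "is_class C \<longleftrightarrow>
     C \<subseteq> cayley_perms \<and>
     (\<forall>x \<in> C. \<forall>y \<in> cayley_perms. contains x y \<longrightarrow> y \<in> C)"

definition basis :: "nat list set \<Rightarrow> nat list set" where
  "basis C =
     {b \<in> cayley_perms - C. \<forall>y \<in> cayley_perms - C. contains b y \<longrightarrow> y = b}"

text \<open>A stack is a list whose head is the top. \<open>stack_push \<sigma> x s\<close> returns the letters popped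
  before \<open>x\<close> can be pushed, in the order in which they are popped, and the stack after the push.
  A letter can always be pushed on the empty stack, as \<open>\<sigma>\<close> has length at least 2 in all uses.\<close>

fun stack_push :: "nat list \<Rightarrow> nat \<Rightarrow> nat list \<Rightarrow> nat list \<times> nat list" where
  "stack_push \<sigma> x [] = ([], [x])"
| "stack_push \<sigma> x (y # s) =
     (if contains (x # y # s) \<sigma>
      then (let (out, s') = stack_push \<sigma> x s in (y # out, s'))
      else ([], x # y # s))"

fun stack_run :: "nat list \<Rightarrow> nat list \<Rightarrow> nat list \<Rightarrow> nat list" where
  "stack_run \<sigma> s [] = s"
| "stack_run \<sigma> s (x # xs) =
     (let (out, s') = stack_push \<sigma> x s in out @ stack_run \<sigma> s' xs)"

definition stack_sort :: "nat list \<Rightarrow> nat list \<Rightarrow> nat list" where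
  "stack_sort \<sigma> w = stack_run \<sigma> [] w"

definition sortable_cay :: "nat list \<Rightarrow> nat list set" where
  "sortable_cay \<sigma> = {w \<in> cayley_perms. sorted (stack_sort [2, 1] (stack_sort \<sigma> w))}"

fun swap_first_two :: "nat list \<Rightarrow> nat list" where
  "swap_first_two (a # b # w) = b # a # w"
| "swap_first_two w = w"

end

theory Submission
  imports Defs "HOL-Library.Sublist"
begin

text \<open>
  Write \<open>\<sigma> = x # y # s\<close>, so that the swapped word is \<open>y # x # s\<close>. Passing a word through the
  21-stack sorts it exactly when the word avoids 231 (\<open>sorted_stack_sort_21\<close>), hence \<open>w\<close> is
  \<open>\<sigma>\<close>-sortable iff \<open>stack_sort \<sigma> w\<close> avoids 231.

  If \<open>w\<close> avoids \<open>rev \<sigma>\<close>, the \<open>\<sigma>\<close>-stack never pops early and simply reverses \<open>w\<close>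
  (\<open>stack_sort_no_pop\<close>). Otherwise some letter is popped early. The last letter popped before a
  push plays \<open>y\<close>, the letter then pushed plays \<open>x\<close>, and the letters below play \<open>s\<close>; they leave in
  the order \<open>y\<close>, \<open>x\<close>, \<open>s\<close>, so the output contains \<open>y # x # s\<close> (\<open>stack_sort_contains_swap\<close>).
  When \<open>y # x # s\<close> contains 231, the sortable Cayley permutations are therefore the ones that avoid
  132 and \<open>rev \<sigma>\<close>. This is a class, and its basis consists of the minimal ones of these two patterns.

  When \<open>y # x # s\<close> avoids 231, a sortable word \<open>p\<close> that contains an unsortable word \<open>q\<close> shows that
  there is no class. Sortability depends only on the relative order of the letters, so \<open>p\<close> and \<open>q\<close>
  need not be Cayley permutations (\<open>not_class_witness\<close>), and the letters of \<open>\<sigma>\<close> may be doubled to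
  make room for new letters between and below them (\<open>not_class\<close>). Unless \<open>\<sigma> = 231\<close>, the word 132 is
  unsortable, because it is reversed to 231; except in this case, every \<open>p\<close> uses one mechanism: it is
  \<open>rev \<sigma>\<close> with further letters inserted, and the push of \<open>x\<close> flushes everything from the top of the
  stack down to the \<open>y\<close> that belongs to \<open>\<sigma>\<close>, so that the output is \<open>y # x # s\<close> together with some
  letters that take no part in 231. With \<open>c\<close> above and \<open>a\<close> below all letters of \<open>\<sigma>\<close>,
  and writing stack contents from top to bottom, the stack just before \<open>x\<close> is pushed is as follows.

  \<^item> If \<open>x \<le> y\<close>, it is \<open>c # y # a # s\<close>, and \<open>a c x\<close> is an occurrence of 132.

  \<^item> If \<open>y < x \<le> v\<close> for some \<open>v\<close> in \<open>s\<close>, it is \<open>c # y # s\<close>, and \<open>y c x\<close> is an occurrence of 132.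

  \<^item> If \<open>x\<close> is above all other letters, then \<open>y\<close> is minimal, as the swapped word avoids 231. If
    \<open>y\<close> does not occur in \<open>s\<close>, the stack is \<open>y # s\<close>, and a final letter \<open>b\<close> just above \<open>y\<close> is
    added after \<open>x\<close>; it makes the occurrence \<open>y x b\<close> of 132, and \<open>y\<close> has left before \<open>b\<close> arrives.

  \<^item> If in the last situation \<open>y\<close> does occur in \<open>s\<close>, the stack is \<open>y # a # y # s\<close>. Here \<open>q\<close> is not
    132 but \<open>p\<close> without the deeper of the two copies of \<open>y\<close> on top: then \<open>x\<close> flushes only the
    upper \<open>y\<close>, and the output has the occurrence \<open>y x a\<close> of 231.

  For \<open>\<sigma> = 231\<close> an explicit pair of words is checked by computation (\<open>not_class_231\<close>).
\<close>

section \<open>Pattern containment through subsequences\<close>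

lemma subseq_nth_strict_mono:
  assumes "strict_mono_on {..<n} i" "\<forall>s<n. i s < length x"
  shows "subseq (map (\<lambda>s. x ! i s) [0..<n]) x"
  using assms
proof (induction n arbitrary: x)
  case (Suc n)
  have lt: "i s < i n" if "s < n" for s
    using Suc.prems(1) that by (auto simp: strict_mono_on_def)
  have "subseq (map (\<lambda>s. take (i n) x ! i s) [0..<n]) (take (i n) x)"
    using Suc.prems lt by (intro Suc.IH) (auto simp: strict_mono_on_def)
  also have "map (\<lambda>s. take (i n) x ! i s) [0..<n] = map (\<lambda>s. x ! i s) [0..<n]"
    using lt by simp
  finally have "subseq (map (\<lambda>s. x ! i s) [0..<n]) (take (i n) x)" .
  then have "subseq (map (\<lambda>s. x ! i s) [0..<n] @ [x ! i n]) (take (i n) x @ [x ! i n])"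
    by simp
  also have "take (i n) x @ [x ! i n] = take (Suc (i n)) x"
    using Suc.prems(2) by (simp add: take_Suc_conv_app_nth)
  also have "subseq \<dots> x"
    by (metis append_take_drop_id list_emb_append2 prefix_imp_subseq take_is_prefix)
  finally show ?case by simp
qed simp

lemma subseq_imp_strict_mono_nth:
  assumes "subseq z x"
  shows "\<exists>i. strict_mono_on {..<length z} i \<and>
             (\<forall>s<length z. i s < length x \<and> z ! s = x ! i s)"
  using assms
proof (induction rule: list_emb.induct)
  case (list_emb_Nil ys)
  show ?case by (simp add: strict_mono_on_def)
next
  case (list_emb_Cons xs ys y)
  then obtain i where "strict_mono_on {..<length xs} i"
      "\<forall>s<length xs. i s < length ys \<and> xs ! s = ys ! i s" by blast
  then show ?case
    by (intro exI[of _ "\<lambda>s. Suc (i s)"]) (auto simp: strict_mono_on_def)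
next
  case (list_emb_Cons2 a b xs ys)
  then obtain i where "strict_mono_on {..<length xs} i"
      "\<forall>s<length xs. i s < length ys \<and> xs ! s = ys ! i s" by blast
  with \<open>a = b\<close> show ?case
    by (intro exI[of _ "\<lambda>s. case s of 0 \<Rightarrow> 0 | Suc t \<Rightarrow> Suc (i t)"])
      (auto simp: strict_mono_on_def split: nat.splits)
qed

text \<open>Index embeddings are replaced by an order-isomorphic subsequence and a relabelling \<open>f\<close> of its
  letters. The value of \<open>f\<close> at a letter does not depend on the chosen position, because containment
  makes equal letters of the subsequence correspond to equal letters of the pattern.\<close>

lemma contains_iff_subseq:
  "contains x y \<longleftrightarrow> (\<exists>z f. subseq z x \<and> strict_mono_on (set z) f \<and> y = map f z)"
proof
  assume "contains x y"
  then obtain i where i: "strict_mono_on {..<length y} i" "\<forall>s<length y. i s < length x"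
    and iso: "\<forall>s<length y. \<forall>t<length y. (x ! i s < x ! i t \<longleftrightarrow> y ! s < y ! t) \<and>
               (x ! i s = x ! i t \<longleftrightarrow> y ! s = y ! t)"
    unfolding contains_def by blast
  define z where "z = map (\<lambda>s. x ! i s) [0..<length y]"
  have len: "length z = length y" and zn: "\<And>s. s < length y \<Longrightarrow> z ! s = x ! i s"
    by (auto simp: z_def)
  define f where "f v = y ! (SOME s. s < length y \<and> z ! s = v)" for v
  have f: "f (z ! s) = y ! s" if "s < length y" for s
  proof -
    define t where "t = (SOME t. t < length y \<and> z ! t = z ! s)"
    have "t < length y \<and> z ! t = z ! s"
      unfolding t_def by (rule someI[of _ s]) (simp add: that)
    then have "y ! t = y ! s" using iso zn that by metis
    then show ?thesis by (simp add: f_def t_def)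
  qed
  have "strict_mono_on (set z) f"
    using f iso zn by (auto simp: strict_mono_on_def in_set_conv_nth len)
  moreover have "y = map f z" using f len by (auto intro: nth_equalityI)
  moreover have "subseq z x" unfolding z_def using i by (rule subseq_nth_strict_mono)
  ultimately show "\<exists>z f. subseq z x \<and> strict_mono_on (set z) f \<and> y = map f z" by blast
next
  assume "\<exists>z f. subseq z x \<and> strict_mono_on (set z) f \<and> y = map f z"
  then obtain z f where z: "subseq z x" "strict_mono_on (set z) f" "y = map f z" by blast
  obtain i where i: "strict_mono_on {..<length z} i"
      "\<forall>s<length z. i s < length x \<and> z ! s = x ! i s"
    using subseq_imp_strict_mono_nth[OF z(1)] by blast
  have "(z ! s < z ! t \<longleftrightarrow> f (z ! s) < f (z ! t)) \<and> (z ! s = z ! t \<longleftrightarrow> f (z ! s) = f (z ! t))"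
    if "s < length z" "t < length z" for s t
    using that z(2) by (simp add: strict_mono_on_less strict_mono_on_eq)
  then show "contains x y"
    unfolding contains_def using i z(3) by (intro exI[of _ i]) auto
qed

lemma containsI: "subseq z x \<Longrightarrow> strict_mono_on (set z) f \<Longrightarrow> contains x (map f z)"
  by (auto simp: contains_iff_subseq)

lemma containsE:
  assumes "contains x y"
  obtains z f where "subseq z x" "strict_mono_on (set z) f" "y = map f z"
  using assms by (auto simp: contains_iff_subseq)

lemma contains_subseq: "contains x y \<Longrightarrow> subseq x x' \<Longrightarrow> contains x' y"
  by (auto elim!: containsE intro!: containsI elim: subseq_order.order_trans)

lemma subseq_imp_contains: "subseq y x \<Longrightarrow> contains x y"
  using containsI[of y x id] by (simp add: strict_mono_on_def)

lemma contains_length: "contains x y \<Longrightarrow> length y \<le> length x"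
  by (auto elim!: containsE dest: list_emb_length)

lemma subseq_imp_subset: "subseq x y \<Longrightarrow> set x \<subseteq> set y"
  by (auto simp: subseq_conv_nths dest: in_set_nthsD)

lemma subseq_revI: "subseq x y \<Longrightarrow> subseq (rev x) (rev y)"
  by (induction rule: list_emb.induct) (auto intro: subseq_rev_drop_many)

lemma subseq_rev_iff: "subseq (rev x) (rev y) \<longleftrightarrow> subseq x y"
  using subseq_revI[of x y] subseq_revI[of "rev x" "rev y"] by auto

lemma subseq_map_rightE:
  assumes "subseq z (map f x)"
  obtains z' where "subseq z' x" "z = map f z'"
  using assms by (auto simp: subseq_conv_nths nths_map)

text \<open>Relabelling can be undone on the letters that occur, by composing with the inverse of \<open>f\<close>.\<close>

lemma contains_map_left:
  assumes "strict_mono_on (set x) f"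
  shows "contains (map f x) y \<longleftrightarrow> contains x y"
proof
  assume "contains (map f x) y"
  then obtain z g where z: "subseq z (map f x)" "strict_mono_on (set z) g" "y = map g z"
    by (rule containsE)
  from z(1) obtain z' where z': "subseq z' x" "z = map f z'" by (rule subseq_map_rightE)
  have "set z' \<subseteq> set x" using z'(1) by (rule subseq_imp_subset)
  then have "strict_mono_on (set z') (g \<circ> f)"
    using assms z(2) z'(2) by (auto simp: strict_mono_on_def subset_iff)
  then show "contains x y" using containsI[OF z'(1)] z(3) z'(2) by simp
next
  assume "contains x y"
  then obtain z g where z: "subseq z x" "strict_mono_on (set z) g" "y = map g z"
    by (rule containsE)
  have sub: "set z \<subseteq> set x" using z(1) by (rule subseq_imp_subset)
  have inj: "inj_on f (set x)" using assms by (rule strict_mono_on_imp_inj_on)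
  define h where "h = g \<circ> the_inv_into (set x) f"
  have h: "h (f v) = g v" if "v \<in> set z" for v
    using that sub by (auto simp: h_def the_inv_into_f_f[OF inj])
  have "strict_mono_on (set (map f z)) h"
  proof (rule strict_mono_onI)
    fix a b assume "a \<in> set (map f z)" "b \<in> set (map f z)" "a < b"
    then obtain a' b' where "a' \<in> set z" "b' \<in> set z" "a = f a'" "b = f b'" by auto
    with \<open>a < b\<close> show "h a < h b"
      using h sub z(2) assms by (auto simp: strict_mono_on_less subset_iff)
  qed
  moreover have "subseq (map f z) (map f x)" using z(1) by (rule subseq_map)
  ultimately have "contains (map f x) (map h (map f z))" by (rule containsI[rotated])
  moreover have "map h (map f z) = y" using h z(3) by simp
  ultimately show "contains (map f x) y" by simp
qed

lemma contains_trans: "contains x y \<Longrightarrow> contains y z \<Longrightarrow> contains x z"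
  by (auto elim!: containsE[of x y] simp: contains_map_left intro: contains_subseq)

lemma contains_rev: "contains (rev x) (rev y) \<longleftrightarrow> contains x y"
proof -
  have "contains (rev x) (rev y)" if "contains x y" for x y
    using that by (auto elim!: containsE simp: rev_map intro!: containsI subseq_revI)
  from this[of x y] this[of "rev x" "rev y"] show ?thesis by auto
qed

text \<open>A word and its relabelling contain each other.\<close>

lemma contains_map_right:
  assumes "strict_mono f"
  shows "contains x (map f y) \<longleftrightarrow> contains x y"
proof -
  have f: "strict_mono_on (set y) f"
    using assms by (auto simp: strict_mono_on_def strict_mono_def)
  have "contains (map f y) y" "contains y (map f y)"
    using contains_map_left[OF f, of y] containsI[OF _ f, of y] subseq_imp_contains[of y y] by auto
  then show ?thesis using contains_trans by blast
qed

lemma contains_231_iff: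
  "contains w [2, 3, 1] \<longleftrightarrow> (\<exists>b c a. subseq [b, c, a] w \<and> a < b \<and> b < c)"
proof
  assume "contains w [2, 3, 1]"
  then obtain z and f :: "nat \<Rightarrow> nat" where z:
      "subseq z w" "strict_mono_on (set z) f" "[2, 3, 1] = map f z"
    by (rule containsE)
  then obtain b c a where "z = [b, c, a]" "f b = 2" "f c = 3" "f a = 1"
    by (auto simp: Cons_eq_map_conv)
  moreover from this have "a < b" "b < c"
    using z(2) strict_mono_on_less[of "set z" f a b] strict_mono_on_less[of "set z" f b c] by auto
  ultimately show "\<exists>b c a. subseq [b, c, a] w \<and> a < b \<and> b < c" using z(1) by blast
next
  assume "\<exists>b c a. subseq [b, c, a] w \<and> a < b \<and> b < c"
  then obtain b c a where *: "subseq [b, c, a] w" "a < b" "b < c" by blast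
  define f :: "nat \<Rightarrow> nat" where "f v = (if v = a then 1 else if v = b then 2 else 3)" for v
  have "strict_mono_on (set [b, c, a]) f" using * by (auto simp: f_def strict_mono_on_def)
  with *(1) have "contains w (map f [b, c, a])" by (rule containsI)
  then show "contains w [2, 3, 1]" using * by (simp add: f_def)
qed

lemma contains_132_iff:
  "contains w [1, 3, 2] \<longleftrightarrow> (\<exists>a c b. subseq [a, c, b] w \<and> a < b \<and> b < c)"
proof -
  have "contains w [1, 3, 2] \<longleftrightarrow> contains (rev w) [2, 3, 1]"
    using contains_rev[of w "[1, 3, 2]"] by simp
  also have "\<dots> \<longleftrightarrow> (\<exists>a c b. subseq (rev [a, c, b]) (rev w) \<and> a < b \<and> b < c)"
    unfolding contains_231_iff by auto
  also have "\<dots> \<longleftrightarrow> (\<exists>a c b. subseq [a, c, b] w \<and> a < b \<and> b < c)"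
    unfolding subseq_rev_iff ..
  finally show ?thesis .
qed

lemma contains_21_iff:
  "contains w [2, 1] \<longleftrightarrow> (\<exists>b a. subseq [b, a] w \<and> a < b)"
proof
  assume "contains w [2, 1]"
  then obtain z and f :: "nat \<Rightarrow> nat" where z:
      "subseq z w" "strict_mono_on (set z) f" "[2, 1] = map f z"
    by (rule containsE)
  then obtain b a where "z = [b, a]" "f b = 2" "f a = 1"
    by (auto simp: Cons_eq_map_conv)
  moreover from this have "a < b"
    using z(2) strict_mono_on_less[of "set z" f a b] by auto
  ultimately show "\<exists>b a. subseq [b, a] w \<and> a < b" using z(1) by blast
next
  assume "\<exists>b a. subseq [b, a] w \<and> a < b"
  then obtain b a where *: "subseq [b, a] w" "a < b" by blast
  define f :: "nat \<Rightarrow> nat" where "f v = (if v = a then 1 else 2)" for v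
  have "strict_mono_on (set [b, a]) f" using * by (auto simp: f_def strict_mono_on_def)
  with *(1) have "contains w (map f [b, a])" by (rule containsI)
  then show "contains w [2, 1]" using * by (simp add: f_def)
qed

text \<open>The simplifier would turn patterns such as \<open>[2, 3, 1]\<close> into \<open>[2, 3, Suc 0]\<close>, and facts about them
  would no longer apply.\<close>

declare One_nat_def [simp del]

section \<open>Standardization\<close>

text \<open>Every letter is replaced by its rank among the distinct letters that occur: this is the Cayley
  permutation order-isomorphic to \<open>w\<close>.\<close>

definition standardize :: "nat list \<Rightarrow> nat list" where
  "standardize w = map (\<lambda>v. card {u \<in> set w. u \<le> v}) w"

lemma strict_mono_on_rank:
  fixes A :: "nat set"
  assumes "finite A"
  shows "strict_mono_on A (\<lambda>v. card {u \<in> A. u \<le> v})"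
proof (rule strict_mono_onI)
  fix a b assume "a \<in> A" "b \<in> A" "a < b"
  then have "{u \<in> A. u \<le> a} \<subseteq> {u \<in> A. u \<le> b}" "b \<in> {u \<in> A. u \<le> b} - {u \<in> A. u \<le> a}"
    by auto
  then have "{u \<in> A. u \<le> a} \<subset> {u \<in> A. u \<le> b}" by blast
  then show "card {u \<in> A. u \<le> a} < card {u \<in> A. u \<le> b}"
    using assms by (intro psubset_card_mono) auto
qed

lemma cayley_permsI:
  assumes "set w = {1..m}"
  shows "w \<in> cayley_perms"
proof (cases "m = 0")
  case False
  then have "Max {1..m} = m" by (intro Max_eqI) auto
  then show ?thesis using assms by (simp add: cayley_perms_def)
qed (use assms in \<open>simp add: cayley_perms_def\<close>)

lemma standardize_in_cayley_perms: "standardize w \<in> cayley_perms"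
proof (rule cayley_permsI)
  let ?r = "\<lambda>v. card {u \<in> set w. u \<le> v}"
  have "inj_on ?r (set w)"
    by (intro strict_mono_on_imp_inj_on strict_mono_on_rank) simp
  then have "card (set (standardize w)) = card (set w)" by (simp add: standardize_def card_image)
  moreover have "1 \<le> ?r v \<and> ?r v \<le> card (set w)" if "v \<in> set w" for v
  proof -
    have "{v} \<subseteq> {u \<in> set w. u \<le> v}" "{u \<in> set w. u \<le> v} \<subseteq> set w" using that by auto
    then have "card {v} \<le> ?r v" "?r v \<le> card (set w)" by (intro card_mono; simp)+
    then show ?thesis by simp
  qed
  then have "set (standardize w) \<subseteq> {1..card (set w)}" by (auto simp: standardize_def)
  with \<open>card (set (standardize w)) = card (set w)\<close> show "set (standardize w) = {1..card (set w)}" by (simp add: card_subset_eq)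
qed

lemma standardize_map:
  assumes "strict_mono_on (set w) f"
  shows "standardize (map f w) = standardize w"
proof -
  have "card {u \<in> f ` set w. u \<le> f v} = card {u \<in> set w. u \<le> v}" if "v \<in> set w" for v
  proof -
    have "{u \<in> f ` set w. u \<le> f v} = f ` {u \<in> set w. u \<le> v}"
      using that assms by (auto simp: strict_mono_on_less_eq)
    moreover have "inj_on f {u \<in> set w. u \<le> v}"
      using strict_mono_on_imp_inj_on[OF assms] by (rule inj_on_subset) auto
    ultimately show ?thesis by (simp add: card_image)
  qed
  then show ?thesis by (simp add: standardize_def)
qed

text \<open>In a Cayley permutation the letters up to \<open>v\<close> are \<open>1, \<dots>, v\<close>, so the rank of \<open>v\<close> is \<open>v\<close>.\<close>

lemma standardize_cayley_perm:
  assumes "w \<in> cayley_perms"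
  shows "standardize w = w"
proof -
  have "card {u \<in> set w. u \<le> v} = v" if "v \<in> set w" for v
  proof -
    from assms that have "set w = {1..Max (set w)}" by (auto simp: cayley_perms_def)
    then obtain m where "set w = {1..m}" ..
    with that have "{u \<in> set w. u \<le> v} = {1..v}" by auto
    then show ?thesis by simp
  qed
  then show ?thesis by (simp add: standardize_def map_idI)
qed

text \<open>Here the pattern is a relabelling of the whole word, so both have the same standardization.\<close>

lemma cayley_perms_contains_length_eq:
  assumes "x \<in> cayley_perms" "y \<in> cayley_perms" "contains x y" "length x \<le> length y"
  shows "x = y"
proof -
  obtain z f where z: "subseq z x" "strict_mono_on (set z) f" "y = map f z"
    using assms(3) by (rule containsE)
  then have "z = x" using assms(4) by (metis length_map list_emb_length subseq_same_length le_antisym)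
  then have "standardize y = standardize x" using z by (simp add: standardize_map)
  then show ?thesis using assms(1,2) by (simp add: standardize_cayley_perm)
qed

lemma cayley_perms_contains_antisym:
  "x \<in> cayley_perms \<Longrightarrow> y \<in> cayley_perms \<Longrightarrow> contains x y \<Longrightarrow> contains y x \<Longrightarrow> x = y"
  by (simp add: cayley_perms_contains_length_eq contains_length)

lemma rev_in_cayley_perms: "rev w \<in> cayley_perms \<longleftrightarrow> w \<in> cayley_perms"
  by (simp add: cayley_perms_def)

lemma pattern_132_in_cayley_perms: "[1, 3, 2] \<in> cayley_perms"
  by (rule cayley_permsI[of _ 3]) auto

section \<open>Runs of a stack\<close>

text \<open>The hypotheses say that \<open>u\<close> is the right set of letters to pop: before its last letter is popped \<open>x\<close>
  still cannot be pushed, and hence not earlier either, as the stack was then larger.\<close>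

lemma stack_push_append:
  assumes "avoids (x # t) \<sigma>" and "u = [] \<or> contains (x # last u # t) \<sigma>"
  shows "stack_push \<sigma> x (u @ t) = (u, x # t)"
  using assms(2)
proof (induction u)
  case Nil
  show ?case
  proof (cases t)
    case (Cons y t')
    then show ?thesis using assms(1) by simp
  qed simp
next
  case (Cons y u)
  have "(y # u) @ t = butlast (y # u) @ last (y # u) # t"
    using append_butlast_last_id[of "y # u"] by (metis append.assoc append_Cons append_Nil list.distinct(1))
  then have "subseq (last (y # u) # t) ((y # u) @ t)"
    using subseq_drop_many[of "last (y # u) # t" "last (y # u) # t"] by simp
  then have "subseq (x # last (y # u) # t) (x # (y # u) @ t)" by simp
  then have "contains (x # (y # u) @ t) \<sigma>" using Cons.prems contains_subseq by blast
  moreover have "stack_push \<sigma> x (u @ t) = (u, x # t)"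
    using Cons by (cases "u = []") auto
  ultimately show ?case by simp
qed

text \<open>Pushing on the empty stack succeeds because \<open>\<sigma>\<close> has at least two letters.\<close>

lemma stack_push_cases:
  assumes "length \<sigma> \<ge> 2"
  obtains u t where "s = u @ t" "stack_push \<sigma> x s = (u, x # t)" "avoids (x # t) \<sigma>"
    "u = [] \<or> contains (x # last u # t) \<sigma>"
proof -
  have "\<exists>u t. s = u @ t \<and> avoids (x # t) \<sigma> \<and> (u = [] \<or> contains (x # last u # t) \<sigma>)"
  proof (induction s)
    case Nil
    have "avoids [x] \<sigma>" using contains_length[of "[x]" \<sigma>] assms by auto
    then show ?case by auto
  next
    case (Cons y s)
    show ?case
    proof (cases "contains (x # y # s) \<sigma>")
      case False
      then show ?thesis by (intro exI[of _ "[]"] exI[of _ "y # s"]) auto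
    next
      case True
      from Cons.IH obtain u t where *: "s = u @ t" "avoids (x # t) \<sigma>"
        "u = [] \<or> contains (x # last u # t) \<sigma>" by blast
      then show ?thesis using True by (intro exI[of _ "y # u"] exI[of _ t]) auto
    qed
  qed
  then show ?thesis using that stack_push_append by blast
qed

lemma stack_run_push:
  assumes "avoids (x # t) \<sigma>" and "u = [] \<or> contains (x # last u # t) \<sigma>"
  shows "stack_run \<sigma> (u @ t) (x # w) = u @ stack_run \<sigma> (x # t) w"
  using stack_push_append[OF assms] by simp

lemma stack_run_no_pop:
  assumes "avoids (rev v @ s) \<sigma>"
  shows "stack_run \<sigma> s (v @ w) = stack_run \<sigma> (rev v @ s) w"
  using assms
proof (induction v arbitrary: s)
  case (Cons x v)
  have "avoids (x # s) \<sigma>"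
    using Cons.prems contains_subseq[of "x # s" \<sigma>] by (auto intro: subseq_drop_many)
  then show ?case using stack_run_push[of x s \<sigma> "[]"] Cons by simp
qed simp

lemma stack_sort_no_pop: "avoids w (rev \<sigma>) \<Longrightarrow> stack_sort \<sigma> w = rev w"
  using stack_run_no_pop[of w "[]" \<sigma> "[]"] contains_rev[of "rev w" \<sigma>]
  by (simp add: stack_sort_def)

text \<open>Nothing is popped while \<open>u @ t\<close> is built up; then \<open>x\<close> flushes \<open>u\<close>. This is the
  single step in which the witnesses for \<open>\<sigma> \<noteq> 231\<close> pop letters early.\<close>

lemma stack_run_one_pop:
  assumes "avoids (u @ t) \<sigma>" "avoids (x # t) \<sigma>" "u = [] \<or> contains (x # last u # t) \<sigma>"
  shows "stack_run \<sigma> [] (rev (u @ t) @ x # w) = u @ stack_run \<sigma> (x # t) w"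
  using stack_run_no_pop[of "rev (u @ t)" "[]" \<sigma> "x # w"] stack_run_push[OF assms(2,3)] assms(1)
  by simp

lemma set_stack_push: "stack_push \<sigma> x s = (u, t) \<Longrightarrow> set u \<union> set t = set (x # s)"
proof (induction s arbitrary: u t)
  case (Cons y s)
  obtain u' t' where *: "stack_push \<sigma> x s = (u', t')" by (rule prod.exhaust)
  show ?case
  proof (cases "contains (x # y # s) \<sigma>")
    case True
    then have "u = y # u'" "t = t'" using Cons.prems * by simp_all
    then show ?thesis using Cons.IH[OF *] by (simp add: insert_commute)
  next
    case False
    then show ?thesis using Cons.prems by simp
  qed
qed simp

lemma set_stack_run: "set (stack_run \<sigma> s w) = set s \<union> set w"
proof (induction w arbitrary: s)
  case (Cons x w)
  obtain u t where ut: "stack_push \<sigma> x s = (u, t)" by (rule prod.exhaust)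
  have "set (stack_run \<sigma> s (x # w)) = (set u \<union> set t) \<union> set w"
    using ut Cons.IH by (simp add: Un_assoc)
  also have "\<dots> = set s \<union> set (x # w)"
    unfolding set_stack_push[OF ut] by simp
  finally show ?case .
qed simp

text \<open>Letters on the stack are output from top to bottom, whatever is pushed in between.\<close>

lemma subseq_stack_run: "length \<sigma> \<ge> 2 \<Longrightarrow> subseq s (stack_run \<sigma> s w)"
proof (induction w arbitrary: s)
  case (Cons x w)
  obtain u t where ut: "s = u @ t" "stack_push \<sigma> x s = (u, x # t)"
    by (rule stack_push_cases[OF Cons.prems, of s x])
  have "subseq t (x # t)" by auto
  also have "subseq (x # t) (stack_run \<sigma> (x # t) w)" using Cons by blast
  finally show ?case using ut by (simp add: list_emb_append_mono)
qed simp

text \<open>At the first push of \<open>x\<close> that pops a letter, let \<open>y\<close> be the last letter popped and \<open>t\<close> the remaining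
  stack. As neither \<open>x # t\<close> nor the old stack contains \<open>\<sigma>\<close>, the occurrence of \<open>\<sigma>\<close> in \<open>x # y # t\<close>
  uses both \<open>x\<close> and \<open>y\<close>. Letters on the stack leave it in order, so \<open>y\<close>, \<open>x\<close>, \<open>t\<close> is a subsequence of
  the output.\<close>

lemma stack_run_contains_swap:
  assumes "length \<sigma> \<ge> 2" "avoids s \<sigma>" "contains (rev w @ s) \<sigma>"
  shows "contains (stack_run \<sigma> s w) (swap_first_two \<sigma>)"
  using assms(2,3)
proof (induction w arbitrary: s)
  case Nil
  then show ?case by simp
next
  case (Cons x w)
  obtain u t where ut: "s = u @ t" "stack_push \<sigma> x s = (u, x # t)" "avoids (x # t) \<sigma>"
      "u = [] \<or> contains (x # last u # t) \<sigma>"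
    by (rule stack_push_cases[OF assms(1), of s x])
  show ?case
  proof (cases "u = []")
    case True
    then show ?thesis using Cons ut by simp
  next
    case False
    define y where "y = last u"
    have u: "u = butlast u @ [y]" using False by (simp add: y_def)
    then have s: "s = butlast u @ y # t" using ut(1) by simp
    have "subseq (y # t) s" unfolding s by (intro subseq_drop_many) simp
    then have yt: "avoids (y # t) \<sigma>" using Cons.prems(1) contains_subseq by blast
    have "contains (x # y # t) \<sigma>" using ut(4) False by (simp add: y_def)
    then obtain z f where z: "subseq z (x # y # t)" "strict_mono_on (set z) f" "\<sigma> = map f z"
      by (rule containsE)
    have notsub: "\<not> subseq z (x # t)" "\<not> subseq z (y # t)"
      using z ut(3) yt containsI by blast+
    obtain z' where z': "z = x # y # z'" "subseq z' t"
      using z(1) notsub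
      by (cases z; cases "tl z") (auto split: if_splits)
    have "subseq (y # x # z') (y # x # t)" using z'(2) by simp
    also have "subseq \<dots> (y # stack_run \<sigma> (x # t) w)"
      using subseq_stack_run[OF assms(1)] by blast
    also have "subseq \<dots> (butlast u @ y # stack_run \<sigma> (x # t) w)"
      by (intro subseq_drop_many) simp
    also have "\<dots> = u @ stack_run \<sigma> (x # t) w" by (subst (2) u) simp
    also have "\<dots> = stack_run \<sigma> s (x # w)" using ut(2) by simp
    finally have "contains (stack_run \<sigma> s (x # w)) (map f (y # x # z'))"
      using z(2) z'(1) by (intro containsI) (auto simp: insert_commute)
    then show ?thesis using z(3) z'(1) by simp
  qed
qed

lemma stack_sort_contains_swap:
  assumes "length \<sigma> \<ge> 2" "contains w (rev \<sigma>)"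
  shows "contains (stack_sort \<sigma> w) (swap_first_two \<sigma>)"
  unfolding stack_sort_def
proof (rule stack_run_contains_swap[OF assms(1)])
  show "avoids [] \<sigma>" using contains_length[of "[]" \<sigma>] assms(1) by auto
  show "contains (rev w @ []) \<sigma>" using contains_rev[of "rev w" \<sigma>] assms(2) by simp
qed

section \<open>The 21-stack sorts the words avoiding 231\<close>

lemma avoids_21_iff_sorted: "avoids w [2, 1] \<longleftrightarrow> sorted w"
proof -
  have *: "subseq [b, a] (x # w) \<longleftrightarrow> b = x \<and> a \<in> set w \<or> subseq [b, a] w" for a b x w
    by (auto simp: subseq_singleton_left dest: subseq_Cons')
  show ?thesis
    unfolding contains_21_iff by (induction w) (simp, auto simp: * not_less not_le simp del: subseq_Cons2_iff)
qed

lemma filter_less_append_filter_ge: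
  fixes x :: "'a :: linorder"
  assumes "sorted s"
  shows "filter (\<lambda>v. v < x) s @ filter (\<lambda>v. x \<le> v) s = s"
  using assms
proof (induction s)
  case (Cons y s)
  show ?case
  proof (cases "y < x")
    case False
    then have "\<forall>v \<in> set s. x \<le> v" using Cons.prems by auto
    then show ?thesis using False by (auto simp: filter_empty_conv not_less)
  qed (use Cons in auto)
qed simp

text \<open>The stack is weakly increasing from top to bottom, so the letters smaller than \<open>x\<close> are on top.\<close>

lemma stack_push_21:
  assumes "sorted s"
  shows "stack_push [2, 1] x s = (filter (\<lambda>v. v < x) s, x # filter (\<lambda>v. x \<le> v) s)"
proof -
  let ?u = "filter (\<lambda>v. v < x) s" and ?t = "filter (\<lambda>v. x \<le> v) s"
  have "avoids (x # ?t) [2, 1]"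
    unfolding avoids_21_iff_sorted using assms by (simp add: sorted_wrt_filter)
  moreover have "?u = [] \<or> contains (x # last ?u # ?t) [2, 1]"
  proof (cases "?u = []")
    case False
    then have "last ?u < x" using last_in_set[of ?u] by auto
    then show ?thesis unfolding contains_21_iff by (intro disjI2 exI[of _ x] exI[of _ "last ?u"]) auto
  qed simp
  ultimately show ?thesis
    using stack_push_append[of x ?t "[2, 1]" ?u] filter_less_append_filter_ge[OF assms] by simp
qed

text \<open>Letters waiting on the stack can play the 2 of an occurrence of 231 whose 3 and 1 are still to come:
  the 3 expels the 2 before the 1 arrives. Nothing else spoils the order of the output.\<close>

lemma sorted_stack_run_21:
  assumes "sorted s"
  shows "sorted (stack_run [2, 1] s w) \<longleftrightarrow>
    (\<forall>b c a. subseq [b, c, a] w \<longrightarrow> \<not> (a < b \<and> b < c)) \<and>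
    (\<forall>b \<in> set s. \<forall>c a. subseq [c, a] w \<longrightarrow> \<not> (a < b \<and> b < c))"
  using assms
proof (induction w arbitrary: s)
  case Nil
  then show ?case by simp
next
  case (Cons x w)
  let ?u = "filter (\<lambda>v. v < x) s" and ?t = "filter (\<lambda>v. x \<le> v) s"
  have *: "subseq (v # vs) (x # w) \<longleftrightarrow> v = x \<and> subseq vs w \<or> subseq (v # vs) w" for v vs
    by (auto dest: subseq_Cons')
  have t: "sorted (x # ?t)" using Cons.prems by (simp add: sorted_wrt_filter)
  have "sorted (stack_run [2, 1] s (x # w)) \<longleftrightarrow>
      sorted (stack_run [2, 1] (x # ?t) w) \<and> (\<forall>b \<in> set ?u. \<forall>a \<in> set w. b \<le> a)"
    using Cons.prems by (auto simp: stack_push_21 sorted_append set_stack_run sorted_wrt_filter)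
  also have "\<dots> \<longleftrightarrow> (\<forall>b c a. subseq [b, c, a] w \<longrightarrow> \<not> (a < b \<and> b < c)) \<and>
      (\<forall>b \<in> set (x # ?t). \<forall>c a. subseq [c, a] w \<longrightarrow> \<not> (a < b \<and> b < c)) \<and>
      (\<forall>b \<in> set s. \<forall>a \<in> set w. \<not> (a < b \<and> b < x))"
    unfolding Cons.IH[OF t] by (auto simp: not_less)
  also have "\<dots> \<longleftrightarrow> (\<forall>b c a. subseq [b, c, a] (x # w) \<longrightarrow> \<not> (a < b \<and> b < c)) \<and>
      (\<forall>b \<in> set s. \<forall>c a. subseq [c, a] (x # w) \<longrightarrow> \<not> (a < b \<and> b < c))"
  proof -
    have in_w: "a \<in> set w" if "subseq [c, a] w" for c a
      using subseq_imp_subset[OF that] by simp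
    have old: "\<not> (a < b \<and> b < c)"
      if "\<forall>b \<in> set (x # ?t). \<forall>c a. subseq [c, a] w \<longrightarrow> \<not> (a < b \<and> b < c)"
        "\<forall>b \<in> set s. \<forall>a \<in> set w. \<not> (a < b \<and> b < x)" "b \<in> set s" "subseq [c, a] w" for b c a
      using that in_w[of c a] by (cases "b < x") auto
    show ?thesis (is "?A \<and> ?B \<and> ?C \<longleftrightarrow> ?D \<and> ?E")
    proof
      assume L: "?A \<and> ?B \<and> ?C"
      have "\<not> (a < b \<and> b < c)" if "subseq [b, c, a] (x # w)" for b c a
      proof (cases "subseq [b, c, a] w")
        case True
        then show ?thesis using L by blast
      next
        case False
        then have "b \<in> set (x # ?t)" "subseq [c, a] w" using that *[of b "[c, a]"] by auto
        then show ?thesis using L by blast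
      qed
      moreover have "\<not> (a < b \<and> b < c)" if b: "b \<in> set s" and ca: "subseq [c, a] (x # w)" for b c a
      proof (cases "subseq [c, a] w")
        case True
        then show ?thesis using old[OF _ _ b] L by blast
      next
        case False
        then have "c = x" "a \<in> set w"
          using ca *[of c "[a]"] by (auto simp: subseq_singleton_left)
        then show ?thesis using L b by blast
      qed
      ultimately show "?D \<and> ?E" by blast
    next
      assume R: "?D \<and> ?E"
      have "\<not> (a < b \<and> b < c)" if "subseq [b, c, a] w" for b c a
      proof -
        have "subseq [b, c, a] (x # w)" using that by (rule list_emb_Cons)
        then show ?thesis using R by blast
      qed
      moreover have "\<not> (a < b \<and> b < c)" if b: "b \<in> set (x # ?t)" and ca: "subseq [c, a] w" for b c a
      proof (cases "b = x")
        case True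
        then have "subseq [b, c, a] (x # w)" using ca by simp
        then show ?thesis using R by blast
      next
        case False
        then have "b \<in> set s" using b by simp
        moreover have "subseq [c, a] (x # w)" using ca by (rule list_emb_Cons)
        ultimately show ?thesis using R by blast
      qed
      moreover have "\<not> (a < b \<and> b < x)" if "b \<in> set s" "a \<in> set w" for b a
      proof -
        have "subseq [x, a] (x # w)" using that(2) by (simp add: subseq_singleton_left)
        then show ?thesis using R that(1) by blast
      qed
      ultimately show "?A \<and> ?B \<and> ?C" by blast
    qed
  qed
  finally show ?case .
qed

lemma sorted_stack_sort_21: "sorted (stack_sort [2, 1] w) \<longleftrightarrow> avoids w [2, 3, 1]"
  unfolding stack_sort_def contains_231_iff using sorted_stack_run_21[of "[]" w] by simp blast

section \<open>Sortability of words and of their standardizations\<close>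

lemma contains_standardize_left: "contains (standardize w) y \<longleftrightarrow> contains w y"
  unfolding standardize_def by (intro contains_map_left strict_mono_on_rank) simp

lemma contains_standardize_right: "contains x (standardize y) \<longleftrightarrow> contains x y"
proof -
  have "contains y (standardize y)"
    unfolding standardize_def by (intro containsI strict_mono_on_rank) simp_all
  moreover have "contains (standardize y) y" by (simp add: contains_standardize_left subseq_imp_contains)
  ultimately show ?thesis using contains_trans[of x y] contains_trans[of x "standardize y" y] by blast
qed

lemma stack_push_map:
  assumes "strict_mono_on (set (x # s)) f"
  shows "stack_push \<sigma> (f x) (map f s) = map_prod (map f) (map f) (stack_push \<sigma> x s)"
  using assms
proof (induction \<sigma> x s rule: stack_push.induct)
  case (2 \<sigma> x y s)
  have "contains (f x # f y # map f s) \<sigma> \<longleftrightarrow> contains (x # y # s) \<sigma>"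
    using contains_map_left[OF 2(2), of \<sigma>] by simp
  moreover have "strict_mono_on (set (x # s)) f"
    using 2(2) by (rule monotone_on_subset) auto
  ultimately show ?case using 2(1) by (auto split: prod.splits)
qed simp

text \<open>The machine uses nothing but comparisons of letters.\<close>

lemma stack_run_map:
  assumes "strict_mono_on (set s \<union> set w) f"
  shows "stack_run \<sigma> (map f s) (map f w) = map f (stack_run \<sigma> s w)"
  using assms
proof (induction w arbitrary: s)
  case (Cons x w)
  obtain u t where ut: "stack_push \<sigma> x s = (u, t)" by (rule prod.exhaust)
  have "set (x # s) \<subseteq> set s \<union> set (x # w)" "set t \<union> set w \<subseteq> set s \<union> set (x # w)"
    using set_stack_push[OF ut, symmetric] by auto
  then have "strict_mono_on (set (x # s)) f" "strict_mono_on (set t \<union> set w) f"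
    using Cons.prems monotone_on_subset by blast+
  then show ?case using Cons.IH[of t] stack_push_map[of x s f \<sigma>] ut by simp
qed simp

lemma stack_sort_standardize: "stack_sort \<sigma> (standardize w) = map (\<lambda>v. card {u \<in> set w. u \<le> v}) (stack_sort \<sigma> w)"
  unfolding stack_sort_def standardize_def
  by (subst stack_run_map[of "[]", simplified]) (simp_all add: strict_mono_on_rank)

lemma set_stack_sort: "set (stack_sort \<sigma> w) = set w"
  by (simp add: stack_sort_def set_stack_run)

lemma sortable_cay_iff:
  "w \<in> sortable_cay \<sigma> \<longleftrightarrow> w \<in> cayley_perms \<and> avoids (stack_sort \<sigma> w) [2, 3, 1]"
  by (simp add: sortable_cay_def sorted_stack_sort_21)

lemma standardize_in_sortable_cay_iff:
  "standardize w \<in> sortable_cay \<sigma> \<longleftrightarrow> avoids (stack_sort \<sigma> w) [2, 3, 1]"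
proof -
  have "strict_mono_on (set (stack_sort \<sigma> w)) (\<lambda>v. card {u \<in> set w. u \<le> v})"
    by (simp add: set_stack_sort strict_mono_on_rank)
  then show ?thesis
    by (simp add: sortable_cay_iff standardize_in_cayley_perms stack_sort_standardize contains_map_left)
qed

text \<open>Standardizing \<open>p\<close> and \<open>q\<close> gives Cayley permutations with the same containment and sortability.\<close>

lemma not_class_witness:
  assumes "contains p q" "avoids (stack_sort \<sigma> p) [2, 3, 1]" "contains (stack_sort \<sigma> q) [2, 3, 1]"
  shows "\<not> is_class (sortable_cay \<sigma>)"
proof
  assume "is_class (sortable_cay \<sigma>)"
  moreover have "standardize p \<in> sortable_cay \<sigma>" "standardize q \<notin> sortable_cay \<sigma>"
    using assms(2,3) by (simp_all add: standardize_in_sortable_cay_iff)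
  moreover have "contains (standardize p) (standardize q)"
    using assms(1) by (simp add: contains_standardize_left contains_standardize_right)
  ultimately show False using standardize_in_cayley_perms[of q] unfolding is_class_def by blast
qed

section \<open>The case of a class\<close>

lemma sortable_cay_eq_avoiders:
  assumes "length \<sigma> \<ge> 2" "contains (swap_first_two \<sigma>) [2, 3, 1]"
  shows "sortable_cay \<sigma> = {w \<in> cayley_perms. \<forall>b \<in> {[1, 3, 2], rev \<sigma>}. avoids w b}"
proof -
  have "avoids (stack_sort \<sigma> w) [2, 3, 1] \<longleftrightarrow> avoids w [1, 3, 2] \<and> avoids w (rev \<sigma>)" for w
  proof (cases "contains w (rev \<sigma>)")
    case True
    then have "contains (stack_sort \<sigma> w) [2, 3, 1]"
      using contains_trans[OF stack_sort_contains_swap[OF assms(1)] assms(2)] by simp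
    then show ?thesis using True by simp
  next
    case False
    have "contains (rev w) [2, 3, 1] \<longleftrightarrow> contains w [1, 3, 2]"
      using contains_rev[of w "[1, 3, 2]"] by simp
    then show ?thesis using False stack_sort_no_pop[of w \<sigma>] by simp
  qed
  then show ?thesis unfolding set_eq_iff sortable_cay_iff by simp
qed

lemma is_class_avoiders: "is_class {w \<in> cayley_perms. \<forall>b \<in> B. avoids w b}"
  unfolding is_class_def
proof (intro conjI ballI impI)
  show "{w \<in> cayley_perms. \<forall>b \<in> B. avoids w b} \<subseteq> cayley_perms" by blast
next
  fix x y assume x: "x \<in> {w \<in> cayley_perms. \<forall>b \<in> B. avoids w b}"
    and y: "y \<in> cayley_perms" "contains x y"
  have "avoids y b" if "b \<in> B" for b
    using x that contains_trans[OF y(2), of b] by blast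
  then show "y \<in> {w \<in> cayley_perms. \<forall>b \<in> B. avoids w b}" using y(1) by blast
qed

text \<open>A Cayley permutation outside the class contains a member of \<open>B\<close>, which is itself outside, so the
  minimal ones lie in \<open>B\<close>; conversely, what a member of \<open>B\<close> properly contains lies in the class, as
  \<open>B\<close> is an antichain.\<close>

lemma basis_avoiders:
  assumes "B \<subseteq> cayley_perms" "\<And>b b'. b \<in> B \<Longrightarrow> b' \<in> B \<Longrightarrow> contains b b' \<Longrightarrow> b = b'"
  shows "basis {w \<in> cayley_perms. \<forall>b \<in> B. avoids w b} = B" (is "basis ?C = B")
proof
  have refl: "b \<in> cayley_perms - ?C" if "b \<in> B" for b
  proof -
    have "contains b b" by (rule subseq_imp_contains) simp
    then show ?thesis using that assms(1) by blast
  qed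
  show "basis ?C \<subseteq> B"
  proof
    fix w assume "w \<in> basis ?C"
    then have w: "w \<in> cayley_perms - ?C" "\<And>y. y \<in> cayley_perms - ?C \<Longrightarrow> contains w y \<Longrightarrow> y = w"
      unfolding basis_def by simp_all
    obtain b where b: "b \<in> B" "contains w b" using w(1) by blast
    then have "b = w" using w(2)[OF refl] by simp
    then show "w \<in> B" using b(1) by simp
  qed
  show "B \<subseteq> basis ?C"
  proof
    fix b assume b: "b \<in> B"
    have "w = b" if w: "w \<in> cayley_perms - ?C" "contains b w" for w
    proof -
      obtain b' where b': "b' \<in> B" "contains w b'" using w(1) by blast
      have "contains w b"
        using assms(2)[OF b b'(1) contains_trans[OF w(2) b'(2)]] b'(2) by simp
      then show ?thesis using cayley_perms_contains_antisym[of w b] w b assms(1) by blast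
    qed
    then show "b \<in> basis ?C"
      unfolding basis_def using refl[OF b] by simp
  qed
qed

section \<open>Letters that an occurrence cannot use\<close>

text \<open>An occurrence of a pattern that is at least as long as the word uses every letter of the word.\<close>

lemma contains_same_lengthE:
  assumes "contains w y" "length w \<le> length y"
  obtains f where "strict_mono_on (set w) f" "y = map f w"
proof -
  obtain z f where z: "subseq z w" "strict_mono_on (set z) f" "y = map f z"
    using assms(1) by (rule containsE)
  then have "z = w" using assms(2) list_emb_length[OF z(1)] subseq_same_length[OF z(1)] by simp
  then show ?thesis using that z by blast
qed

text \<open>The letter \<open>c\<close> could only play the first letter \<open>x\<close> of the pattern, and that would make \<open>x\<close> larger
  than all letters after it. Besides removing large letters from the stack, this serves for the
  pattern 231.\<close>

lemma contains_drop_max: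
  assumes "contains (c # w) (x # y)" "\<forall>v \<in> set w. v < c" "\<exists>v \<in> set y. x \<le> v"
  shows "contains w (x # y)"
proof -
  obtain z f where z: "subseq z (c # w)" "strict_mono_on (set z) f" "x # y = map f z"
    using assms(1) by (rule containsE)
  have "subseq z w"
  proof (rule ccontr)
    assume "\<not> subseq z w"
    then obtain z' where z': "z = c # z'" "subseq z' w"
      using z(1) by (cases z) (auto split: if_splits)
    obtain v where v: "v \<in> set z'" "x \<le> f v" using assms(3) z(3) z'(1) by auto
    then have "v < c" using assms(2) subseq_imp_subset[OF z'(2)] by auto
    then have "f v < f c" using strict_mono_onD[OF z(2)] v z'(1) by simp
    then show False using v z(3) z'(1) by simp
  qed
  then show ?thesis using z(2,3) containsI by simp
qed

text \<open>Filtering out \<open>a\<close> leaves \<open>z\<close> unchanged.\<close>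

lemma subseq_remove_unused:
  assumes "subseq z (u @ a # v)" "a \<notin> set z"
  shows "subseq z (u @ v)"
proof -
  have "subseq (filter (\<lambda>b. b \<noteq> a) z) (filter (\<lambda>b. b \<noteq> a) (u @ a # v))"
    using assms(1) by (rule subseq_filter)
  also have "filter (\<lambda>b. b \<noteq> a) z = z" using assms(2) by (auto simp: filter_id_conv)
  also have "filter (\<lambda>b. b \<noteq> a) (u @ a # v) = filter (\<lambda>b. b \<noteq> a) (u @ v)" by simp
  also have "subseq \<dots> (u @ v)" by (rule subseq_filter_left)
  finally show ?thesis .
qed

text \<open>If the minimal letter \<open>a\<close> were used, it would play the minimum \<open>m\<close> of the pattern. It occurs once, but
  \<open>m\<close> occurs at least twice.\<close>

lemma contains_drop_min:
  assumes "contains (u @ a # v) \<sigma>" "\<forall>w \<in> set u \<union> set v. a < w"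
    and "\<forall>w \<in> set \<sigma>. m \<le> w" "count_list \<sigma> m \<ge> 2"
  shows "contains (u @ v) \<sigma>"
proof -
  obtain z f where z: "subseq z (u @ a # v)" "strict_mono_on (set z) f" "\<sigma> = map f z"
    using assms(1) by (rule containsE)
  have sub: "set z \<subseteq> insert a (set u \<union> set v)" using subseq_imp_subset[OF z(1)] by auto
  have "a \<notin> set z"
  proof
    assume a: "a \<in> set z"
    have "m \<in> set \<sigma>" using assms(4) by (metis count_list_0_iff not_numeral_le_zero)
    then obtain v' where v': "v' \<in> set z" "f v' = m" using z(3) by auto
    have "f v' \<le> f a" using assms(3) z(3) a v' by simp
    moreover have "a < v'" if "v' \<noteq> a" using that assms(2) sub v'(1) by auto
    ultimately have "v' = a" using strict_mono_onD[OF z(2) a v'(1)] by (cases "v' = a") simp_all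
    then have "m = f b \<longleftrightarrow> b = a" if "b \<in> set z" for b
      using strict_mono_on_eq[OF z(2) that a] v'(2) by auto
    then have "filter (\<lambda>b. m = f b) z = filter (\<lambda>b. b = a) z" by (intro filter_cong) simp_all
    then have "count_list \<sigma> m = length (filter (\<lambda>b. b = a) z)"
      unfolding z(3) by (simp add: count_list_eq_length_filter filter_map comp_def)
    also have "\<dots> \<le> length (filter (\<lambda>b. b = a) (u @ a # v))"
      using z(1) by (rule list_emb_length[OF subseq_filter])
    also have "\<dots> = 1"
    proof -
      have "filter (\<lambda>b. b = a) u = [] \<and> filter (\<lambda>b. b = a) v = []"
        using assms(2) unfolding filter_empty_conv by blast
      then show ?thesis by simp
    qed
    finally show False using assms(4) by simp
  qed
  then have "subseq z (u @ v)" by (rule subseq_remove_unused[OF z(1)])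
  then show ?thesis using z(2,3) containsI by simp
qed

text \<open>A weakly minimal first letter cannot play the 2.\<close>

lemma contains_231_drop_min:
  assumes "contains (h # w) [2, 3, 1]" "\<forall>v \<in> set w. h \<le> v"
  shows "contains w [2, 3, 1]"
proof -
  obtain b c a where *: "subseq [b, c, a] (h # w)" "a < b" "b < c"
    using assms(1) by (auto simp: contains_231_iff)
  have "b \<noteq> h"
  proof
    assume "b = h"
    then have "a \<in> set w" using *(1) subseq_imp_subset[of "[c, a]" w] by simp
    then show False using assms(2) *(2) \<open>b = h\<close> by auto
  qed
  then show ?thesis using * by (auto simp: contains_231_iff)
qed

text \<open>A minimal letter can only play the 1, and the weakly decreasing prefix before it has no ascent to
  play 23.\<close>

lemma contains_231_remove_min:
  assumes "contains (u @ a # v) [2, 3, 1]" "\<forall>w \<in> set u \<union> set v. a < w" "sorted (rev u)"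
  shows "contains (u @ v) [2, 3, 1]"
proof -
  obtain b' c' a' where *: "subseq [b', c', a'] (u @ a # v)" "a' < b'" "b' < c'"
    using assms(1) by (auto simp: contains_231_iff)
  have "a \<notin> set [b', c', a']"
  proof
    assume "a \<in> set [b', c', a']"
    moreover have "a \<le> a'" using subseq_imp_subset[OF *(1)] assms(2) by (auto intro: less_imp_le)
    ultimately have a: "a = a'" using *(2,3) by auto
    obtain z1 z2 where z: "[b', c', a'] = z1 @ z2" "subseq z1 u" "subseq z2 (a # v)"
      using *(1) unfolding subseq_append_iff by blast
    have "a \<notin> set u" "a \<notin> set v" using assms(2) by auto
    then have "a' \<notin> set z1" "\<not> subseq [c', a'] v" "\<not> subseq [b', c', a'] v"
      using a subseq_imp_subset[OF z(2)] subseq_imp_subset[of "[c', a']" v]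
        subseq_imp_subset[of "[b', c', a']" v] by auto
    then have "z1 = [b', c']"
      using z(1,3) *(2,3) a by (auto simp: Cons_eq_append_conv split: if_splits)
    then have "subseq [c', b'] (rev u)" using subseq_revI[OF z(2)] by simp
    then show False using assms(3) *(3) avoids_21_iff_sorted contains_21_iff by blast
  qed
  then have "subseq [b', c', a'] (u @ v)" by (rule subseq_remove_unused[OF *(1)])
  then show ?thesis using *(2,3) contains_231_iff by blast
qed

section \<open>Sortable words with unsortable patterns\<close>

text \<open>The inserted letters trigger no early pop: \<open>c\<close> is too large to play \<open>x\<close>, and neither \<open>y # a # s\<close> nor
  \<open>x # a # s\<close> is isomorphic to \<open>\<sigma>\<close>, since in both the second letter is smaller than the first. So only
  the last push pops letters, namely \<open>c\<close> and \<open>y\<close>. The output \<open>c # y # x # a # s\<close> differs from the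
  swapped word by \<open>c\<close> and \<open>a\<close>, which cannot take part in 231: before \<open>a\<close> there is only the weakly
  decreasing word \<open>c\<close>, \<open>y\<close>, \<open>x\<close>.\<close>

lemma sortable_witness_le:
  assumes "avoids (y # x # s) [2, 3, 1]" "x \<le> y"
    and a: "\<forall>v \<in> set (x # y # s). a < v" and c: "\<forall>v \<in> set (x # y # s). v < c"
  defines "p \<equiv> rev (c # y # a # s) @ [x]"
  shows "contains p [1, 3, 2]" "avoids (stack_sort (x # y # s) p) [2, 3, 1]"
proof -
  let ?\<sigma> = "x # y # s"
  have "subseq [a, c, x] p"
    by (simp add: p_def subseq_drop_many)
  then show "contains p [1, 3, 2]"
    unfolding contains_132_iff using a c by (intro exI[of _ a] exI[of _ c] exI[of _ x]) simp
  have "avoids (y # a # s) ?\<sigma>"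
  proof
    assume "contains (y # a # s) ?\<sigma>"
    then obtain f where f: "strict_mono_on (set (y # a # s)) f" "?\<sigma> = map f (y # a # s)"
      by (rule contains_same_lengthE) simp
    then have "f a < f y" using strict_mono_onD[OF f(1), of a y] a by simp
    then show False using f(2) assms(2) by simp
  qed
  then have 1: "avoids ([c, y] @ a # s) ?\<sigma>"
    using contains_drop_max[of c "y # a # s" x "y # s"] a c assms(2) by auto
  have 2: "avoids (x # a # s) ?\<sigma>"
  proof
    assume "contains (x # a # s) ?\<sigma>"
    then obtain f where f: "strict_mono_on (set (x # a # s)) f" "?\<sigma> = map f (x # a # s)"
      by (rule contains_same_lengthE) simp
    then have "f a < f x" using strict_mono_onD[OF f(1), of a x] a by simp
    then show False using f(2) assms(2) by simp
  qed
  have 3: "contains (x # last [c, y] # a # s) ?\<sigma>"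
    by (intro subseq_imp_contains) (simp add: list_emb_Cons)
  have "stack_sort ?\<sigma> p = [c, y] @ x # a # s"
    using stack_run_one_pop[OF 1 2, of "[]"] 3 by (simp add: p_def stack_sort_def)
  moreover have "avoids ([y, x] @ a # s) [2, 3, 1]"
    using contains_231_remove_min[of "[y, x]" a s] assms(1,2) a by auto
  then have "avoids (c # y # x # a # s) [2, 3, 1]"
    using contains_drop_max[of c "y # x # a # s" 2 "[3, 1]"] a c by auto
  ultimately show "avoids (stack_sort ?\<sigma> p) [2, 3, 1]" by simp
qed

text \<open>As \<open>x\<close> is not above all of \<open>s\<close>, the large letter \<open>c\<close> cannot play \<open>x\<close> and does not pop \<open>y\<close>. The letters
  \<open>y c x\<close> form 132, but \<open>c\<close> leaves the stack before \<open>x\<close> is pushed on it.\<close>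

lemma sortable_witness_gt:
  assumes "avoids (y # x # s) [2, 3, 1]" "y < x" "\<exists>v \<in> set s. x \<le> v"
    and c: "\<forall>v \<in> set (x # y # s). v < c"
  defines "p \<equiv> rev (c # y # s) @ [x]"
  shows "contains p [1, 3, 2]" "avoids (stack_sort (x # y # s) p) [2, 3, 1]"
proof -
  let ?\<sigma> = "x # y # s"
  have "subseq [y, c, x] p"
    by (simp add: p_def subseq_drop_many)
  then show "contains p [1, 3, 2]"
    unfolding contains_132_iff using assms(2) c
    by (intro exI[of _ y] exI[of _ c] exI[of _ x]) simp
  have "avoids (y # s) ?\<sigma>" "avoids (x # s) ?\<sigma>"
    using contains_length[of "y # s" ?\<sigma>] contains_length[of "x # s" ?\<sigma>] by auto
  then have 1: "avoids ([c, y] @ s) ?\<sigma>"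
    using contains_drop_max[of c "y # s" x "y # s"] c assms(3) by auto
  have 3: "contains (x # last [c, y] # s) ?\<sigma>"
    by (intro subseq_imp_contains) (simp add: list_emb_Cons)
  have "stack_sort ?\<sigma> p = [c, y] @ x # s"
    using stack_run_one_pop[OF 1 \<open>avoids (x # s) ?\<sigma>\<close>, of "[]"] 3
    by (simp add: p_def stack_sort_def)
  moreover have "avoids (c # y # x # s) [2, 3, 1]"
    using contains_drop_max[of c "y # x # s" 2 "[3, 1]"] assms(1) c by auto
  ultimately show "avoids (stack_sort ?\<sigma> p) [2, 3, 1]" by simp
qed

text \<open>The push of \<open>x\<close> expels \<open>y\<close>, so the letter \<open>b\<close>, which lands on top of \<open>x\<close>, has no smaller letter below
  it that could complete 231.\<close>

lemma sortable_witness_max: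
  assumes "avoids (y # x # s) [2, 3, 1]" "y < b" "b < x" "\<forall>v \<in> set s. b < v"
  defines "p \<equiv> rev (y # s) @ [x, b]"
  shows "contains p [1, 3, 2]" "avoids (stack_sort (x # y # s) p) [2, 3, 1]"
proof -
  let ?\<sigma> = "x # y # s"
  have "subseq [y, x, b] p"
    by (simp add: p_def subseq_drop_many)
  then show "contains p [1, 3, 2]"
    unfolding contains_132_iff using assms(2,3)
    by (intro exI[of _ y] exI[of _ x] exI[of _ b]) simp
  have 1: "avoids ([y] @ s) ?\<sigma>" "avoids (x # s) ?\<sigma>"
    using contains_length[of "y # s" ?\<sigma>] contains_length[of "x # s" ?\<sigma>] by auto
  have 3: "contains (x # last [y] # s) ?\<sigma>"
    by (intro subseq_imp_contains) (simp add: list_emb_Cons)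
  have "avoids (b # x # s) ?\<sigma>"
  proof
    assume "contains (b # x # s) ?\<sigma>"
    then obtain f where f: "strict_mono_on (set (b # x # s)) f" "?\<sigma> = map f (b # x # s)"
      by (rule contains_same_lengthE) simp
    then have "f b < f x" using strict_mono_onD[OF f(1), of b x] assms(3) by simp
    then show False using f(2) assms(2,3) by simp
  qed
  then have "stack_run ?\<sigma> (x # s) [b] = b # x # s"
    using stack_run_no_pop[of "[b]" "x # s" ?\<sigma> "[]"] by simp
  then have out: "stack_sort ?\<sigma> p = y # b # x # s"
    using stack_run_one_pop[OF 1, of "[b]"] 3 by (simp add: p_def stack_sort_def)
  have "avoids (x # s) [2, 3, 1]"
    using assms(1) contains_subseq[of "x # s" "[2, 3, 1]" "y # x # s"]
      list_emb_Cons[of "(=)" "x # s" "x # s" y] by auto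
  moreover have b: "\<forall>v \<in> set (x # s). b \<le> v" using assms(3,4) by (simp add: less_imp_le)
  ultimately have "avoids (b # x # s) [2, 3, 1]"
    using contains_231_drop_min[of b "x # s"] by blast
  moreover have "\<forall>v \<in> set (b # x # s). y \<le> v"
    using b assms(2) by (auto intro: order_trans[of y b])
  ultimately have "avoids (y # b # x # s) [2, 3, 1]"
    using contains_231_drop_min[of y "b # x # s"] by blast
  then show "avoids (stack_sort ?\<sigma> p) [2, 3, 1]" using out by simp
qed

text \<open>The pattern needs its minimum \<open>y\<close> twice, so an occurrence of it cannot use the single letter \<open>a\<close>. In
  \<open>p\<close> the push of \<open>x\<close> has to remove both copies of \<open>y\<close> on top, and \<open>a\<close> between them goes along. In
  \<open>q\<close> only one copy is there, so \<open>a\<close> stays on the stack below \<open>x\<close>.\<close>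

lemma witness_repeated_min:
  assumes "avoids (y # x # s) [2, 3, 1]" "y < x" "y \<in> set s"
    and y: "\<forall>v \<in> set s. y \<le> v" and a: "a < y"
  defines "p \<equiv> rev (y # a # y # s) @ [x]" and "q \<equiv> rev (y # a # s) @ [x]"
  shows "contains p q" "avoids (stack_sort (x # y # s) p) [2, 3, 1]"
    "contains (stack_sort (x # y # s) q) [2, 3, 1]"
proof -
  let ?\<sigma> = "x # y # s"
  have "subseq (rev q) (rev p)"
    by (simp add: p_def q_def list_emb_Cons)
  then show "contains p q" using subseq_rev_iff[of q p] subseq_imp_contains by simp
  have min: "\<forall>v \<in> set ?\<sigma>. y \<le> v" using y assms(2) by auto
  have as: "\<forall>v \<in> set s. a < v" using y a by auto
  have "count_list s y \<noteq> 0" using assms(3) count_list_0_iff[of s y] by simp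
  then have two: "count_list ?\<sigma> y \<ge> 2" by simp
  have short: "avoids (x # s) ?\<sigma>" "avoids (y # s) ?\<sigma>"
    using contains_length[of "y # s" ?\<sigma>] contains_length[of "x # s" ?\<sigma>] by auto

  have "avoids (y # y # s) ?\<sigma>"
  proof
    assume "contains (y # y # s) ?\<sigma>"
    then obtain f where f: "?\<sigma> = map f (y # y # s)"
      by (rule contains_same_lengthE) simp
    then show False using assms(2) by simp
  qed
  then have 1: "avoids ([y, a, y] @ s) ?\<sigma>"
    using contains_drop_min[of "[y]" a "y # s" ?\<sigma> y] min two as a by auto
  have 3: "contains (x # last [y, a, y] # s) ?\<sigma>"
    by (intro subseq_imp_contains) (simp add: list_emb_Cons)
  have "stack_sort ?\<sigma> p = y # a # y # x # s"
    using stack_run_one_pop[OF 1 short(1), of "[]"] 3 by (simp add: p_def stack_sort_def)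
  moreover have "avoids (y # y # x # s) [2, 3, 1]"
    using contains_231_drop_min[of y "y # x # s"] y assms(1,2) by auto
  then have "avoids ([y] @ a # y # x # s) [2, 3, 1]"
    using contains_231_remove_min[of "[y]" a "y # x # s"] as a assms(2) by auto
  ultimately show "avoids (stack_sort ?\<sigma> p) [2, 3, 1]" by simp

  have 4: "avoids ([y] @ a # s) ?\<sigma>"
    using contains_drop_min[of "[y]" a s ?\<sigma> y] min two as a short by auto
  have 5: "avoids (x # a # s) ?\<sigma>"
    using contains_drop_min[of "[x]" a s ?\<sigma> y] min two as a short assms(2) by auto
  have 6: "contains (x # last [y] # a # s) ?\<sigma>"
    by (intro subseq_imp_contains) (simp add: list_emb_Cons)
  have "stack_sort ?\<sigma> q = y # x # a # s"
    using stack_run_one_pop[OF 4 5, of "[]"] 6 by (simp add: q_def stack_sort_def)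
  moreover have "contains (y # x # a # s) [2, 3, 1]"
    unfolding contains_231_iff using a assms(2)
    by (intro exI[of _ y] exI[of _ x] exI[of _ a]) simp
  ultimately show "contains (stack_sort ?\<sigma> q) [2, 3, 1]" by simp
qed

text \<open>Even positive letters leave \<open>0\<close> free below all of them and \<open>Suc y\<close> free just above \<open>y\<close>.\<close>

lemma not_class_if_gaps:
  assumes "length \<sigma> \<ge> 3" "avoids (swap_first_two \<sigma>) [2, 3, 1]" "avoids [2, 3, 1] \<sigma>"
    and gaps: "\<forall>v \<in> set \<sigma>. 0 < v \<and> even v"
  shows "\<not> is_class (sortable_cay \<sigma>)"
proof -
  obtain x y s where \<sigma>: "\<sigma> = x # y # s"
    using assms(1) by (auto simp: numeral_3_eq_3 Suc_le_length_iff)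
  have hat: "avoids (y # x # s) [2, 3, 1]" using assms(2) \<sigma> by simp
  have "avoids [1, 3, 2] (rev \<sigma>)"
    using assms(3) contains_rev[of "[2, 3, 1]" \<sigma>] by simp
  then have "stack_sort \<sigma> [1, 3, 2] = [2, 3, 1]" by (simp add: stack_sort_no_pop)
  then have unsortable: "contains (stack_sort \<sigma> [1, 3, 2]) [2, 3, 1]"
    by (simp add: subseq_imp_contains)
  note non_class = not_class_witness[OF _ _ unsortable]
  define c where "c = Suc (Max (set \<sigma>))"
  have c: "\<forall>v \<in> set (x # y # s). v < c"
    unfolding c_def less_Suc_eq_le \<sigma>[symmetric] using Max_ge[of "set \<sigma>"] by simp
  have pos: "\<forall>v \<in> set (x # y # s). 0 < v" using gaps \<sigma> by simp
  consider "x \<le> y" | "y < x" "\<exists>v \<in> set s. x \<le> v" | "y < x" "\<forall>v \<in> set s. v < x"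
    by (meson leI)
  then show ?thesis
  proof cases
    case 1
    show ?thesis using non_class[OF sortable_witness_le[OF hat 1 pos c, folded \<sigma>]] .
  next
    case 2
    show ?thesis using non_class[OF sortable_witness_gt[OF hat 2 c, folded \<sigma>]] .
  next
    case 3
    have y: "\<forall>v \<in> set s. y \<le> v"
    proof (intro ballI leI notI)
      fix v assume "v \<in> set s" "v < y"
      then have "subseq [y, x, v] (y # x # s)" by (simp add: subseq_singleton_left)
      with \<open>v < y\<close> 3(1) hat show False unfolding contains_231_iff by blast
    qed
    show ?thesis
    proof (cases "y \<in> set s")
      case True
      show ?thesis
        using not_class_witness[OF witness_repeated_min[OF hat 3(1) True y, of 0]] pos \<sigma> by simp
    next
      case False
      have "Suc y < v" if "v \<in> insert x (set s)" for v
      proof -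
        have "y < v" using that y False 3(1) by (cases "v = y") (auto simp: order_less_le)
        moreover have "even v" "even y" using that gaps \<sigma> by auto
        ultimately show ?thesis by (metis Suc_lessI even_Suc)
      qed
      then have b: "y < Suc y" "Suc y < x" "\<forall>v \<in> set s. Suc y < v" by simp_all
      show ?thesis using non_class[OF sortable_witness_max[OF hat b, folded \<sigma>]] .
    qed
  qed
qed

lemma stack_sort_cong:
  assumes "\<And>w. contains w \<sigma> \<longleftrightarrow> contains w \<tau>"
  shows "stack_sort \<sigma> w = stack_sort \<tau> w"
proof -
  have push: "stack_push \<sigma> x s = stack_push \<tau> x s" for x s
    by (induction s) (simp_all add: assms)
  have "stack_run \<sigma> s w = stack_run \<tau> s w" for s
    by (induction w arbitrary: s) (simp_all add: push split: prod.split)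
  then show ?thesis by (simp add: stack_sort_def)
qed

lemma swap_first_two_map: "swap_first_two (map f \<sigma>) = map f (swap_first_two \<sigma>)"
  by (induction \<sigma> rule: swap_first_two.induct) simp_all

lemma not_class:
  assumes "length \<sigma> \<ge> 3" "avoids (swap_first_two \<sigma>) [2, 3, 1]" "avoids [2, 3, 1] \<sigma>"
    and "0 \<notin> set \<sigma>"
  shows "\<not> is_class (sortable_cay \<sigma>)"
proof -
  let ?f = "\<lambda>v. 2 * v :: nat"
  have f: "strict_mono ?f" by (simp add: strict_mono_def)
  then have f': "strict_mono_on A ?f" for A by (simp add: strict_mono_on_def)
  have "\<not> is_class (sortable_cay (map ?f \<sigma>))"
  proof (rule not_class_if_gaps)
    show "avoids (swap_first_two (map ?f \<sigma>)) [2, 3, 1]"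
      using assms(2) unfolding swap_first_two_map contains_map_left[OF f'] .
    show "avoids [2, 3, 1] (map ?f \<sigma>)"
      using assms(3) unfolding contains_map_right[OF f] .
    show "\<forall>v \<in> set (map ?f \<sigma>). 0 < v \<and> even v"
      using assms(4) by (auto intro: gr0I)
  qed (use assms(1) in simp)
  moreover have "sortable_cay (map ?f \<sigma>) = sortable_cay \<sigma>"
    unfolding sortable_cay_def
    using stack_sort_cong[of "map ?f \<sigma>" \<sigma>, OF contains_map_right[OF f]] by simp
  ultimately show ?thesis by simp
qed

text \<open>Whether \<open>x\<close>, put in front of \<open>w\<close>, plays the 2 in an occurrence of 231. Together with the next two
  lemmas this makes containment of 231 computable by rewriting.\<close>

definition descends_across :: "nat \<Rightarrow> nat list \<Rightarrow> bool" where
  "descends_across x w \<longleftrightarrow> (\<exists>c a. subseq [c, a] w \<and> a < x \<and> x < c)"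

lemma descends_across_simps:
  "descends_across x [] \<longleftrightarrow> False"
  "descends_across x (y # w) \<longleftrightarrow> x < y \<and> (\<exists>a \<in> set w. a < x) \<or> descends_across x w"
proof -
  show "descends_across x [] \<longleftrightarrow> False" by (simp add: descends_across_def)
  have "subseq [c, a] (y # w) \<longleftrightarrow> subseq [c, a] w \<or> c = y \<and> a \<in> set w" for c a
    using subseq_Cons'[of c "[a]" w] by (auto simp: subseq_singleton_left)
  then show "descends_across x (y # w) \<longleftrightarrow>
      x < y \<and> (\<exists>a \<in> set w. a < x) \<or> descends_across x w"
    unfolding descends_across_def by metis
qed

lemma contains_231_simps:
  "contains [] [2, 3, 1] \<longleftrightarrow> False"
  "contains (x # w) [2, 3, 1] \<longleftrightarrow> contains w [2, 3, 1] \<or> descends_across x w"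
proof -
  show "contains [] [2, 3, 1] \<longleftrightarrow> False"
    using contains_length[of "[]" "[2, 3, 1]"] by auto
  have "subseq [b, c, a] (x # w) \<longleftrightarrow> subseq [b, c, a] w \<or> b = x \<and> subseq [c, a] w" for b c a
    using subseq_Cons'[of b "[c, a]" w] by auto
  then show "contains (x # w) [2, 3, 1] \<longleftrightarrow> contains w [2, 3, 1] \<or> descends_across x w"
    unfolding contains_231_iff descends_across_def by metis
qed

text \<open>Here 132 is sortable. When \<open>?q\<close> is read, 4 and the second 2 are both on the stack until 3 expels
  them, and \<open>2 4 1\<close> appears in the output. The additional 1 at the front of \<open>?p\<close> lies at the bottom
  of the stack, where it makes the second 2 expel 4 at once, so that 4 leads the output.\<close>

lemma not_class_231: "\<not> is_class (sortable_cay [2, 3, 1])"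
proof (rule not_class_witness)
  note eval = stack_sort_def contains_231_simps descends_across_simps
  let ?p = "[1, 2, 4, 2, 3, 1]" and ?q = "[2, 4, 2, 3, 1]"
  show "contains ?p ?q" by (intro subseq_imp_contains) simp
  have "stack_sort [2, 3, 1] ?p = [4, 1, 3, 2, 2, 1]" by (simp add: eval)
  then show "avoids (stack_sort [2, 3, 1] ?p) [2, 3, 1]" by (simp add: eval)
  have "stack_sort [2, 3, 1] ?q = [2, 4, 1, 3, 2]" by (simp add: eval)
  then show "contains (stack_sort [2, 3, 1] ?q) [2, 3, 1]" by (simp add: eval)
qed

text \<open>If 132 contains \<open>rev \<sigma>\<close>, they are equal by length; this makes the two patterns an antichain as soon as
  \<open>rev \<sigma>\<close> avoids 132.\<close>

theorem corollary8p5: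
  fixes \<sigma> :: "nat list"
  assumes "\<sigma> \<in> cayley_perms" and "length \<sigma> \<ge> 3"
  shows "(\<not> is_class (sortable_cay \<sigma>) \<longleftrightarrow> avoids (swap_first_two \<sigma>) [2, 3, 1]) \<and>
    (contains (swap_first_two \<sigma>) [2, 3, 1] \<longrightarrow>
       is_class (sortable_cay \<sigma>) \<and>
       (avoids (rev \<sigma>) [1, 3, 2] \<longrightarrow> basis (sortable_cay \<sigma>) = {[1, 3, 2], rev \<sigma>}) \<and>
       (\<not> avoids (rev \<sigma>) [1, 3, 2] \<longrightarrow> basis (sortable_cay \<sigma>) = {[1, 3, 2]}))"
proof (cases "contains (swap_first_two \<sigma>) [2, 3, 1]")
  case False
  have "\<not> is_class (sortable_cay \<sigma>)"
  proof (cases "contains [2, 3, 1] \<sigma>")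
    case True
    have "[2, 3, 1] \<in> cayley_perms" using pattern_132_in_cayley_perms rev_in_cayley_perms[of "[1, 3, 2]"] by simp
    then have "[2, 3, 1] = \<sigma>"
      using cayley_perms_contains_length_eq[OF _ assms(1) True] assms(2) by simp
    then show ?thesis using not_class_231 by simp
  next
    case avoid: False
    from assms have "set \<sigma> = {1..Max (set \<sigma>)}" by (auto simp: cayley_perms_def)
    then obtain m where "set \<sigma> = {1..m}" ..
    then have "0 \<notin> set \<sigma>" by simp
    then show ?thesis by (rule not_class[OF assms(2) False avoid])
  qed
  then show ?thesis using False by simp
next
  case True
  have \<sigma>: "sortable_cay \<sigma> = {w \<in> cayley_perms. \<forall>b \<in> {[1, 3, 2], rev \<sigma>}. avoids w b}"
    using sortable_cay_eq_avoiders[OF _ True] assms(2) by simp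
  have rev: "rev \<sigma> \<in> cayley_perms" using assms(1) rev_in_cayley_perms by simp
  have "is_class (sortable_cay \<sigma>)" unfolding \<sigma> by (rule is_class_avoiders)
  moreover have "basis (sortable_cay \<sigma>) = {[1, 3, 2], rev \<sigma>}" if avoid: "avoids (rev \<sigma>) [1, 3, 2]"
    unfolding \<sigma>
  proof (rule basis_avoiders)
    show "{[1, 3, 2], rev \<sigma>} \<subseteq> cayley_perms" using pattern_132_in_cayley_perms rev by simp
    have "avoids [1, 3, 2] (rev \<sigma>)"
    proof
      assume *: "contains [1, 3, 2] (rev \<sigma>)"
      then have "[1, 3, 2] = rev \<sigma>"
        using cayley_perms_contains_length_eq[OF pattern_132_in_cayley_perms rev] assms(2) by simp
      with * avoid show False by simp
    qed
    then show "b = b'" if "b \<in> {[1, 3, 2], rev \<sigma>}" "b' \<in> {[1, 3, 2], rev \<sigma>}" "contains b b'" for b b'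
      using that avoid by (elim insertE) simp_all
  qed
  moreover have "basis (sortable_cay \<sigma>) = {[1, 3, 2]}" if "contains (rev \<sigma>) [1, 3, 2]"
  proof -
    have "sortable_cay \<sigma> = {w \<in> cayley_perms. \<forall>b \<in> {[1, 3, 2]}. avoids w b}"
    proof -
      have "avoids w (rev \<sigma>)" if "avoids w [1, 3, 2]" for w
        using contains_trans[of w "rev \<sigma>" "[1, 3, 2]"] that \<open>contains (rev \<sigma>) [1, 3, 2]\<close> by blast
      then show ?thesis unfolding \<sigma> by blast
    qed
    then show ?thesis using basis_avoiders[of "{[1, 3, 2]}"] pattern_132_in_cayley_perms by simp
  qed
  ultimately show ?thesis using True by blast
qed

end
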